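(* If $T=\{T_1,T_2,T_3\}$ is a $3$-way $(v,3,2)$ trade of volume $7$, then $T$ is a $3$-way $(v,3,2)$ Steiner trade.
   Context: Let $V$ be a set of $v$ elements and let $k,t$ be positive integers with $t<k<v$. A block is a $k$-subset of $V$. A $\mu$-way $(v,k,t)$ trade of volume $m$ is a family $T=\{T_1,\dots,T_\mu\}$ of $\mu$ pairwise disjoint collections of blocks (collections may a priori contain repeated blocks), each $T_i$ consisting of exactly $m$ blocks, such that for every $t$-subset $S$ of $V$, the number of blocks of $T_i$ containing $S$ is the same for all $i$. It is a Steiner trade if every $t$-subset of $V$ is contained in at most one block of each $T_i$. *)

theory Defs
  imports "HOL-Library.Multiset"
begin

text \<open>Collections of blocks are multisets, since repeated blocks are allowed. The family
  \<open>T\<^sub>1, \<dots>, T\<^sub>\<mu>\<close> is a function on \<^typ>\<open>nat\<close> of which only the values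
  on \<open>{1..\<mu>}\<close> matter.\<close>

definition blocks_containing :: "'a set \<Rightarrow> 'a set multiset \<Rightarrow> nat" where
  "blocks_containing S C = size {#B \<in># C. S \<subseteq> B#}"

definition way_trade ::
    "nat \<Rightarrow> 'a set \<Rightarrow> nat \<Rightarrow> nat \<Rightarrow> nat \<Rightarrow> nat \<Rightarrow> (nat \<Rightarrow> 'a set multiset) \<Rightarrow> bool" where
  "way_trade \<mu> V v k t m T \<longleftrightarrow>
     finite V \<and> card V = v \<and> 0 < t \<and> t < k \<and> k < v \<and>
     (\<forall>i\<in>{1..\<mu>}. \<forall>B\<in>#T i. B \<subseteq> V \<and> card B = k) \<and>
     (\<forall>i\<in>{1..\<mu>}. size (T i) = m) \<and>
     (\<forall>i\<in>{1..\<mu>}. \<forall>j\<in>{1..\<mu>}. i \<noteq> j \<longrightarrow> T i \<inter># T j = {#}) \<and>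
     (\<forall>S. S \<subseteq> V \<and> card S = t \<longrightarrow>
        (\<forall>i\<in>{1..\<mu>}. \<forall>j\<in>{1..\<mu>}. blocks_containing S (T i) = blocks_containing S (T j)))"

definition way_steiner_trade ::
    "nat \<Rightarrow> 'a set \<Rightarrow> nat \<Rightarrow> nat \<Rightarrow> nat \<Rightarrow> nat \<Rightarrow> (nat \<Rightarrow> 'a set multiset) \<Rightarrow> bool" where
  "way_steiner_trade \<mu> V v k t m T \<longleftrightarrow>
     way_trade \<mu> V v k t m T \<and>
     (\<forall>S. S \<subseteq> V \<and> card S = t \<longrightarrow> (\<forall>i\<in>{1..\<mu>}. blocks_containing S (T i) \<le> 1))"

end

theory Submission
  imports Defs
begin

text \<open>Suppose a pair \<open>{x, y}\<close> lies in \<open>l \<ge> 2\<close> blocks of every \<open>T\<^sub>i\<close>. Write \<open>N\<^sub>i(z)\<close> for the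
  multiplicity of the block \<open>{x, y, z}\<close> in \<open>T\<^sub>i\<close> and \<open>C\<^sub>i(z)\<close> for the number of blocks of \<open>T\<^sub>i\<close>
  that contain \<open>z\<close> and avoid \<open>x\<close> and \<open>y\<close>. Since the \<open>N\<^sub>i\<close> have disjoint supports,
  the number of blocks through \<open>x\<close> and \<open>z\<close> is at least \<open>N\<^sub>1(z) + N\<^sub>2(z) + N\<^sub>3(z)\<close>; summing over
  \<open>z\<close> shows that \<open>x\<close>, and likewise \<open>y\<close>, lies in at least \<open>2l\<close> blocks, so \<open>7 \<ge> 3l + c\<close>,
  where \<open>c\<close> is the number of blocks avoiding both points. By inclusion-exclusion
  \<open>C\<^sub>i(z) - N\<^sub>i(z)\<close> does not depend on \<open>i\<close>, whence \<open>N\<^sub>i \<le> C\<^sub>i\<close> and \<open>c \<ge> 1\<close>. Therefore \<open>l = 2\<close>,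
  \<open>c = 1\<close>, and all the inequalities are equalities. The unique block of \<open>T\<^sub>1\<close> avoiding \<open>x\<close>
  and \<open>y\<close> consists of two points of the support of \<open>N\<^sub>1\<close>, one of them \<open>p\<close>, and a third point \<open>w\<close>
  that occurs in no block with \<open>x\<close> or \<open>y\<close>. But then no block of \<open>T\<^sub>2\<close> can contain \<open>{w, p}\<close>.\<close>

lemma blocks_containing_empty [simp]: "blocks_containing S {#} = 0"
  by (simp add: blocks_containing_def)

lemma blocks_containing_add [simp]:
  "blocks_containing S (add_mset B C) = of_bool (S \<subseteq> B) + blocks_containing S C"
  by (simp add: blocks_containing_def)

lemma blocks_containing_pos_iff: "blocks_containing S C > 0 \<longleftrightarrow> (\<exists>B\<in>#C. S \<subseteq> B)"
  by (induction C) auto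

lemma blocks_containing_antimono:
  "S \<subseteq> S' \<Longrightarrow> blocks_containing S' C \<le> blocks_containing S C"
  by (induction C) (auto simp: of_bool_def)

text \<open>Double counting: a block containing \<open>S\<close> is counted once for each of its
  \<open>k - card S\<close> points outside \<open>S\<close>.\<close>

lemma sum_blocks_containing_insert:
  assumes "finite V" "\<And>B. B \<in># C \<Longrightarrow> B \<subseteq> V \<and> card B = k"
  shows "(\<Sum>z\<in>V - S. blocks_containing (insert z S) C) = (k - card S) * blocks_containing S C"
  using assms(2)
proof (induction C)
  case (add B C)
  have B: "B \<subseteq> V" "card B = k" "finite B"
    using add.prems[of B] assms(1) finite_subset by auto
  have "(\<Sum>z\<in>V - S. of_bool (insert z S \<subseteq> B) :: nat) = (k - card S) * of_bool (S \<subseteq> B)"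
  proof (cases "S \<subseteq> B")
    case True
    then have "(V - S) \<inter> {z. insert z S \<subseteq> B} = B - S"
      using B by auto
    with True B assms(1) show ?thesis
      by (simp add: card_Diff_subset finite_subset flip: of_bool_def)
  qed simp
  with add show ?case
    by (simp add: sum.distrib algebra_simps)
qed simp

definition blocks_avoiding :: "'a \<Rightarrow> 'a \<Rightarrow> 'a set multiset \<Rightarrow> 'a set multiset" where
  "blocks_avoiding x y C = {#B \<in># C. x \<notin> B \<and> y \<notin> B#}"

text \<open>Holds block by block; written additively to avoid truncated subtraction.
  \<open>S = {}\<close> will count all blocks, \<open>S = {z}\<close> those through
  \<open>z\<close>.\<close>

lemma inclusion_exclusion_blocks:
  "blocks_containing S C + blocks_containing (insert x (insert y S)) C =
   blocks_containing (insert x S) C + blocks_containing (insert y S) C +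
   blocks_containing S (blocks_avoiding x y C)"
  by (induction C) (auto simp: blocks_avoiding_def of_bool_def)

text \<open>A block of the same size as \<open>S\<close> that contains \<open>S\<close> is
  \<open>S\<close> itself, so it cannot occur in both collections.\<close>

lemma blocks_containing_eq_0:
  assumes "C \<inter># D = {#}" "\<And>B. B \<in># C + D \<Longrightarrow> card B = card S" "card S > 0"
    "blocks_containing S C > 0"
  shows "blocks_containing S D = 0"
proof (rule ccontr)
  assume "blocks_containing S D \<noteq> 0"
  then obtain B B' where B: "B \<in># C" "S \<subseteq> B" "B' \<in># D" "S \<subseteq> B'"
    using assms(4) unfolding neq0_conv blocks_containing_pos_iff by blast
  then have "card B = card S" "card B' = card S"
    using assms(2) by auto
  with B assms(3) have "S = B" "S = B'"
    by (simp_all add: card_subset_eq card_ge_0_finite)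
  with B have "S \<in># C \<inter># D"
    by simp
  with assms(1) show False
    by simp
qed

lemma trade_pair_le_1:
  assumes trade: "way_trade 3 V v 3 2 7 T" and V: "x \<in> V" "y \<in> V" and "x \<noteq> y"
  shows "blocks_containing {x, y} (T 1) \<le> 1"
proof (rule ccontr)
  define R where "R i S = blocks_containing S (T i)" for i S
  define N where "N i z = R i {x, y, z}" for i z
  define D where "D i = blocks_avoiding x y (T i)" for i
  define C where "C i z = blocks_containing {z} (D i)" for i z
  define W where "W = V - {x, y}"
  define I where "I = {1..3::nat}"
  define l where "l = R 1 {x, y}"
  have I: "1 \<in> I" "2 \<in> I" "3 \<in> I"
    by (auto simp: I_def)
  assume "\<not> blocks_containing {x, y} (T 1) \<le> 1"
  then have l: "l \<ge> 2"
    by (simp add: l_def R_def)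
  have fin: "finite V" "finite W"
    using trade by (auto simp: way_trade_def W_def)
  have block: "B \<subseteq> V" "card B = 3" if "i \<in> I" "B \<in># T i" for i B
    using trade that by (auto simp: way_trade_def I_def)
  have size7: "R i {} = 7" if "i \<in> I" for i
    using trade that by (auto simp: way_trade_def I_def R_def blocks_containing_def)
  have pair: "R i {u, w} = R 1 {u, w}" if "i \<in> I" "u \<in> V" "w \<in> V" "u \<noteq> w" for i u w
  proof -
    have "{u, w} \<subseteq> V \<and> card {u, w} = 2"
      using that by simp
    then show ?thesis
      using trade that(1) I(1) unfolding way_trade_def I_def R_def by blast
  qed
  have double: "(\<Sum>z\<in>V - S. R i (insert z S)) = (3 - card S) * R i S" if "i \<in> I" for i S
    unfolding R_def using sum_blocks_containing_insert[OF fin(1)] block[OF that] by blast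
  have point: "R i {z} = R 1 {z}" if "i \<in> I" "z \<in> V" for i z
  proof -
    have "(\<Sum>u\<in>V - {z}. R i {u, z}) = (\<Sum>u\<in>V - {z}. R 1 {u, z})"
      using that by (intro sum.cong refl pair) auto
    with double[OF that(1), of "{z}"] double[OF I(1), of "{z}"] show ?thesis
      by simp
  qed
  have sumN: "(\<Sum>z\<in>W. N i z) = l" if "i \<in> I" for i
    using double[OF that, of "{x, y}"] pair[OF that V \<open>x \<noteq> y\<close>] \<open>x \<noteq> y\<close>
    by (simp add: W_def N_def l_def insert_commute)
  have disj: "N j z = 0" if "i \<in> I" "j \<in> I" "i \<noteq> j" "z \<in> W" "N i z > 0" for i j z
    using that \<open>x \<noteq> y\<close> trade block unfolding N_def R_def
    by (intro blocks_containing_eq_0[of "T i" "T j"]) (auto simp: W_def I_def way_trade_def)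
  have N_le: "N i z \<le> R 1 {u, z}" if "i \<in> I" "z \<in> W" "u \<in> {x, y}" for i z u
  proof -
    have "N i z \<le> R i {u, z}"
      using that(3) unfolding N_def R_def by (intro blocks_containing_antimono) auto
    with pair[of i u z] that V show ?thesis
      by (auto simp: W_def)
  qed
  have N3_le: "N 1 z + N 2 z + N 3 z \<le> R 1 {u, z}" if "z \<in> W" "u \<in> {x, y}" for z u
  proof -
    \<comment> \<open>By disjointness at most one of the three terms is nonzero, so the sum is
      bounded like a single term.\<close>
    have "N 1 z = 0 \<and> N 2 z = 0 \<or> N 1 z = 0 \<and> N 3 z = 0 \<or> N 2 z = 0 \<and> N 3 z = 0"
      using disj[of 1 2 z] disj[of 1 3 z] disj[of 2 3 z] I that(1)
      by (cases "N 1 z = 0"; cases "N 2 z = 0") auto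
    with N_le[of 1 z u] N_le[of 2 z u] N_le[of 3 z u] I that show ?thesis
      by auto
  qed
  have sumN3: "(\<Sum>z\<in>W. N 1 z + N 2 z + N 3 z) = 3 * l"
    using I by (simp add: sum.distrib sumN)
  have deg: "2 * R 1 {u} = l + (\<Sum>z\<in>W. R 1 {u, z})" if u: "u \<in> {x, y}" for u
  proof -
    obtain u' where u': "{u, u'} = {x, y}" "u \<noteq> u'"
      using u \<open>x \<noteq> y\<close> by (cases "u = x") auto
    then have V_eq: "V - {u} = insert u' W" "u' \<notin> W"
      using V by (auto simp: W_def)
    have "(\<Sum>z\<in>V - {u}. R 1 {z, u}) = l + (\<Sum>z\<in>W. R 1 {u, z})"
      using V_eq fin u' by (simp add: l_def insert_commute)
    with double[OF I(1), of "{u}"] show ?thesis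
      by simp
  qed
  have deg_ge: "R 1 {u} \<ge> 2 * l" if "u \<in> {x, y}" for u
  proof -
    have "3 * l \<le> (\<Sum>z\<in>W. R 1 {u, z})"
      unfolding sumN3[symmetric] using that by (intro sum_mono N3_le)
    with deg[OF that] show ?thesis
      by linarith
  qed
  have total: "7 + l = R 1 {x} + R 1 {y} + size (D i)" if "i \<in> I" for i
    using inclusion_exclusion_blocks[of "{}" "T i" x y] size7[OF that]
      point[OF that] pair[OF that V \<open>x \<noteq> y\<close>] V
    by (simp add: R_def D_def l_def) (simp add: blocks_containing_def)
  have C_le: "C i z \<le> size (D i)" for i z
    unfolding C_def blocks_containing_def by (rule size_filter_mset_lesseq)
  have CN: "C i z + N 1 z = C 1 z + N i z" if "i \<in> I" "z \<in> W" for i z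
  proof -
    have "R j {z} + N j z = R j {x, z} + R j {y, z} + C j z" for j
      using inclusion_exclusion_blocks[of "{z}" "T j" x y] by (simp add: R_def N_def C_def D_def)
    from this[of i] this[of 1] show ?thesis
      using that V point[of i z] pair[of i x z] pair[of i y z] by (auto simp: W_def)
  qed
  \<comment> \<open>If \<open>N 1 z > 0\<close> then \<open>N 2 z = 0\<close>, and \<open>CN\<close>
    reads \<open>C 2 z + N 1 z = C 1 z\<close>.\<close>
  have N_le_C: "N 1 z \<le> C 1 z" if "z \<in> W" for z
    using CN[of 2 z] disj[of 1 2 z] I that by (cases "N 1 z = 0") auto
  have "\<not> (\<forall>z\<in>W. N 1 z = 0)"
    using sumN[OF I(1)] l sum.neutral[of W "N 1"] by linarith
  then obtain p where p: "p \<in> W" "N 1 p > 0"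
    by blast
  have "size (D 1) > 0"
    using N_le_C[OF p(1)] C_le[of 1 p] p(2) by linarith
  \<comment> \<open>\<open>7 + l \<ge> 2 * l + 2 * l + 1\<close> forces
    \<open>l \<le> 2\<close>.\<close>
  then have vals: "l = 2" "R 1 {x} = 4" "R 1 {y} = 4" "size (D 1) = 1"
    using total[OF I(1)] deg_ge[of x] deg_ge[of y] l by auto
  \<comment> \<open>The degrees of \<open>x\<close> and \<open>y\<close> do not depend on
    \<open>i\<close>, so neither does the size of \<open>D i\<close>.\<close>
  have sizeD: "size (D i) = 1" if "i \<in> I" for i
    using total[OF that] vals by simp
  have pair_eq: "R 1 {u, z} = N 1 z + N 2 z + N 3 z" if "z \<in> W" "u \<in> {x, y}" for u z
  \<comment> \<open>A strict inequality at one point would make the sum in \<open>deg\<close> exceed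
    \<open>2 * 4 - 2 = 3 * l\<close>.\<close>
  proof (rule ccontr)
    assume "R 1 {u, z} \<noteq> N 1 z + N 2 z + N 3 z"
    then have "N 1 z + N 2 z + N 3 z < R 1 {u, z}"
      using N3_le[OF that] by simp
    then have "(\<Sum>z\<in>W. N 1 z + N 2 z + N 3 z) < (\<Sum>z\<in>W. R 1 {u, z})"
      using that N3_le by (intro sum_strict_mono_ex1 fin) blast+
    with deg[OF that(2)] sumN3 vals that(2) show False
      by auto
  qed
  obtain B where D1: "D 1 = {#B#}"
    using vals(4) size_1_singleton_mset by blast
  then have "B \<in># D 1"
    by simp
  then have B: "B \<in># T 1" "B \<subseteq> W" "card B = 3"
    using block[OF I(1)] by (auto simp: D_def blocks_avoiding_def W_def)
  have C1: "C 1 z = of_bool (z \<in> B)" for z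
    unfolding C_def D1 by simp
  have pB: "p \<in> B" "N 1 p = 1"
    using N_le_C[OF p(1)] p(2) C1[of p] by (auto simp: of_bool_def split: if_splits)
  \<comment> \<open>Otherwise the three points of \<open>B\<close> would contribute at least 3 to a
    sum equal to \<open>l = 2\<close>.\<close>
  have "\<exists>w\<in>B. N 1 w = 0"
  proof (rule ccontr)
    assume "\<not> (\<exists>w\<in>B. N 1 w = 0)"
    then have "card B \<le> (\<Sum>z\<in>B. N 1 z)"
      using sum_mono[of B "\<lambda>_. 1" "N 1"] by fastforce
    also have "\<dots> \<le> (\<Sum>z\<in>W. N 1 z)"
      using B fin by (intro sum_mono2) auto
    finally show False
      using sumN[OF I(1)] vals B by simp
  qed
  then obtain w where w: "w \<in> B" "N 1 w = 0"
    by blast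
  have wW: "w \<in> W"
    using w B by auto
  \<comment> \<open>Here \<open>CN\<close> gives \<open>C i w = 1 + N i w\<close>, while
    \<open>C i w \<le> 1\<close>.\<close>
  have "N i w = 0" if "i \<in> I" for i
    using CN[OF that wW] C_le[of i w] sizeD[OF that] C1[of w] w by simp
  then have w0: "R 1 {u, w} = 0" if "u \<in> {x, y}" for u
    using pair_eq[OF wW that] I by simp
  have "R 1 {w, p} > 0"
    unfolding R_def blocks_containing_pos_iff using B(1) pB w by auto
  moreover have "w \<noteq> p"
    using pB w by auto
  ultimately have "R 2 {w, p} > 0"
    using pair[of 2 w p] I wW p by (simp add: W_def)
  then obtain B' where B': "B' \<in># T 2" "w \<in> B'" "p \<in> B'"
    unfolding R_def blocks_containing_pos_iff by auto
  have "u \<notin> B'" if "u \<in> {x, y}" for u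
  proof
    assume "u \<in> B'"
    then have "R 2 {u, w} > 0"
      unfolding R_def blocks_containing_pos_iff using B' by auto
    with w0[OF that] pair[of 2 u w] I wW V that show False
      by (auto simp: W_def)
  qed
  then have "B' \<in># D 2"
    using B' by (simp add: D_def blocks_avoiding_def)
  then have "C 2 p > 0"
    unfolding C_def blocks_containing_pos_iff using B' by auto
  \<comment> \<open>\<open>CN\<close> at \<open>p\<close> reads
    \<open>C 2 p + 1 = 1 + 0\<close>.\<close>
  moreover have "C 2 p = 0"
    using CN[of 2 p] disj[of 1 2 p] C1[of p] I p pB by auto
  ultimately show False
    by simp
qed

theorem theorem4p1:
  fixes V :: "'a set" and v :: nat and T :: "nat \<Rightarrow> 'a set multiset"
  assumes "way_trade 3 V v 3 2 7 T"
  shows "way_steiner_trade 3 V v 3 2 7 T"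
  unfolding way_steiner_trade_def
proof (intro conjI allI impI ballI)
  fix S i
  assume S: "S \<subseteq> V \<and> card S = 2" and i: "i \<in> {1..3::nat}"
  then obtain x y where "S = {x, y}" "x \<noteq> y"
    by (meson card_2_iff)
  then have "blocks_containing S (T 1) \<le> 1"
    using trade_pair_le_1[OF assms] S by simp
  moreover have "blocks_containing S (T i) = blocks_containing S (T 1)"
  proof -
    have "1 \<in> {1..3::nat}"
      by simp
    with assms S i show ?thesis
      unfolding way_trade_def by blast
  qed
  ultimately show "blocks_containing S (T i) \<le> 1"
    by simp
qed (fact assms)

end
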